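(* Let $f:\mathbb{R}^d\to\mathbb{R}$ be $d$-times continuously differentiable and assume: (i) there are constants $G,L\ge 0$ with $\|\nabla f(x)\|\le G$ and $\|\nabla f(x')-\nabla f(x)\|\le L\|x'-x\|$ for all $x,x'\in\mathbb{R}^d$; (ii) the sublevel set $\{x: f(x)\le c\}$ is bounded for every $c<\sup f$; (iii) the set $\{x:\|\nabla f(x)\|\le\varepsilon_0\}$ is bounded for some $\varepsilon_0>0$; (iv) for some $q\in[2,\infty]$ and $\sigma\ge 0$, the oracle error satisfies $\mathbb{E}[Z(x;\omega)]=0$ and $\mathbb{E}[\|Z(x;\omega)\|^q]\le\sigma^q$ for all $x\in\mathbb{R}^d$ (for $q=\infty$, the latter means $\|Z(x;\omega)\|\le\sigma$ almost surely). Suppose stochastic gradient descent $X_{n+1}=X_n-\gamma_n V_n$ is run with a step-size sequence of the form $\gamma_n\propto 1/n^p$ for some $p\in(2/(q+2),1]$ (where $2/(q+2)=0$ if $q=\infty$). Then, with probability $1$, every asymptotic pseudotrajectory $X(t)$ of the gradient dynamics $\dot x(t)=-\nabla f(x(t))$ that is induced by stochastic gradient descent satisfies $\sup_{t\ge 0}\|X(t)\|<\infty$.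
   Context: $\|\cdot\|$ is the Euclidean norm on $\mathbb{R}^d$. Oracle and algorithm. A stochastic first-order oracle returns, at input $x\in\mathbb{R}^d$, the random vector $\mathsf V(x;\omega)=\nabla f(x)+Z(x;\omega)$, with $\omega$ drawn from a complete probability space. Stochastic gradient descent (SGD) is $X_{n+1}=X_n-\gamma_n V_n$, $n=1,2,\dots$, with step-sizes $\gamma_n>0$ and $V_n=\mathsf V(X_n;\omega_n)=\nabla f(X_n)+Z_n$, $Z_n=Z(X_n;\omega_n)$, where $\omega_n$ is a fresh draw of the random seed, independent of $\mathcal F_n=\sigma(X_1,\dots,X_n)$; thus $\mathbb{E}[Z_n\mid\mathcal F_n]=0$ and $\mathbb{E}[\|Z_n\|^q\mid\mathcal F_n]\le\sigma^q$. Interpolation. Let $\tau_n=\sum_{k=1}^n\gamma_k$ and let $X(t)=X_n+\frac{t-\tau_n}{\tau_{n+1}-\tau_n}(X_{n+1}-X_n)$ for $t\in[\tau_n,\tau_{n+1}]$, $n\ge 1$ (with the convention $X(t)=X_1$ for $0\le t\le\tau_1$). Asymptotic pseudotrajectory (APT). Let $\Phi_t(x)$ denote the value at time $t\ge 0$ of the solution of $\dot x=-\nabla f(x)$ starting at $x$. A curve $X(t)$ is an APT of the gradient dynamics if $\lim_{t\to\infty}\sup_{0\le h\le T}\|X(t+h)-\Phi_h(X(t))\|=0$ for all $T>0$. An APT induced by SGD is a curve $X(t)$ which is the interpolation of a realization of the SGD iterates and which is an APT. *)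

theory Defs
  imports "HOL-Probability.Probability"
begin

(* For finite-dimensional domains: f is C^(k+1) iff it is (Frechet) differentiable and every
   directional derivative x \<mapsto> Df(x)v is C^k. *)
primrec times_cont_differentiable :: "nat \<Rightarrow> ('a::euclidean_space \<Rightarrow> real) \<Rightarrow> bool" where
  "times_cont_differentiable 0 f \<longleftrightarrow> continuous_on UNIV f"
| "times_cont_differentiable (Suc k) f \<longleftrightarrow>
     (\<forall>x. f differentiable (at x)) \<and>
     (\<forall>v. times_cont_differentiable k (\<lambda>x. frechet_derivative f (at x) v))"

definition grad :: "('a::euclidean_space \<Rightarrow> real) \<Rightarrow> 'a \<Rightarrow> 'a" where
  "grad f x = (THE D. GDERIV f x :> D)"

lemma grad_eqI:
  assumes "GDERIV f x :> D"
  shows "grad f x = D"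
  unfolding grad_def
proof (rule the_equality)
  fix D' assume "GDERIV f x :> D'"
  then have "(\<lambda>h. inner h D') = (\<lambda>h. inner h D)"
    using assms unfolding gderiv_def by (intro has_derivative_unique)
  then show "D' = D"
    by (auto simp: fun_eq_iff vector_eq_ldot)
qed (fact assms)

definition gradient_solution :: "('a::euclidean_space \<Rightarrow> real) \<Rightarrow> 'a \<Rightarrow> (real \<Rightarrow> 'a) \<Rightarrow> bool" where
  "gradient_solution f x y \<longleftrightarrow>
     y 0 = x \<and> (\<forall>t\<ge>0. (y has_vector_derivative - grad f (y t)) (at t within {0..}))"

(* Solutions are only determined on {0..}, so the description singles out the value at t, not the
   solution itself. *)
definition gradient_flow :: "('a::euclidean_space \<Rightarrow> real) \<Rightarrow> real \<Rightarrow> 'a \<Rightarrow> 'a" where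
  "gradient_flow f t x = (THE z. \<exists>y. gradient_solution f x y \<and> y t = z)"

(* The supremum is taken in ereal because SUP on real is unspecified for unbounded sets. *)
definition asymptotic_pseudotrajectory ::
    "('a::euclidean_space \<Rightarrow> real) \<Rightarrow> (real \<Rightarrow> 'a) \<Rightarrow> bool" where
  "asymptotic_pseudotrajectory f Y \<longleftrightarrow>
     continuous_on {0..} Y \<and>
     (\<forall>T>0. ((\<lambda>t. SUP h\<in>{0..T}. ereal (norm (Y (t + h) - gradient_flow f h (Y t))))
               \<longlongrightarrow> 0) at_top)"

definition elapsed_time :: "(nat \<Rightarrow> real) \<Rightarrow> nat \<Rightarrow> real" where
  "elapsed_time \<gamma> n = (\<Sum>k=1..n. \<gamma> k)"

(* Iterates are indexed from 1; the value x 0 is ignored. Y is unconstrained on negative times. *)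
definition interpolates :: "(nat \<Rightarrow> real) \<Rightarrow> (nat \<Rightarrow> 'a::euclidean_space) \<Rightarrow> (real \<Rightarrow> 'a) \<Rightarrow> bool" where
  "interpolates \<gamma> x Y \<longleftrightarrow>
     (\<forall>t\<in>{0..elapsed_time \<gamma> 1}. Y t = x 1) \<and>
     (\<forall>n\<ge>1. \<forall>t\<in>{elapsed_time \<gamma> n..elapsed_time \<gamma> (n + 1)}.
        Y t = x n + ((t - elapsed_time \<gamma> n) / (elapsed_time \<gamma> (n + 1) - elapsed_time \<gamma> n))
                      *\<^sub>R (x (n + 1) - x n))"

(* E[norm Y ^ q] \<le> \<sigma>^q; the nonnegative integral makes finiteness of the moment part of the bound. *)
definition moment_bound ::
    "'s measure \<Rightarrow> ereal \<Rightarrow> real \<Rightarrow> ('s \<Rightarrow> 'a::euclidean_space) \<Rightarrow> bool" where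
  "moment_bound S q \<sigma> Y \<longleftrightarrow>
     (if q = \<infinity> then AE s in S. norm (Y s) \<le> \<sigma>
      else (\<integral>\<^sup>+ s. ennreal (norm (Y s) powr real_of_ereal q) \<partial>S)
             \<le> ennreal (\<sigma> powr real_of_ereal q))"

definition history :: "'w measure \<Rightarrow> (nat \<Rightarrow> 'w \<Rightarrow> 'a::euclidean_space) \<Rightarrow> nat \<Rightarrow> 'w set set" where
  "history M X n =
     sigma_sets (space M) (\<Union>k\<in>{1..n}. {X k -` A \<inter> space M | A. A \<in> sets borel})"

(* M carries the whole process, S is the law of a single random seed. *)
definition sgd ::
    "'w measure \<Rightarrow> 's measure \<Rightarrow> ('a::euclidean_space \<Rightarrow> 's \<Rightarrow> 'a) \<Rightarrow> (nat \<Rightarrow> real) \<Rightarrow>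
     (nat \<Rightarrow> 'w \<Rightarrow> 's) \<Rightarrow> (nat \<Rightarrow> 'w \<Rightarrow> 'a) \<Rightarrow> bool" where
  "sgd M S V \<gamma> \<omega> X \<longleftrightarrow>
     (\<forall>n\<ge>1. X n \<in> borel_measurable M) \<and>
     (\<forall>n\<ge>1. \<omega> n \<in> measurable M S \<and> distr M S (\<omega> n) = S) \<and>
     (\<forall>n\<ge>1. prob_space.indep_set M
               {\<omega> n -` A \<inter> space M | A. A \<in> sets S} (history M X n)) \<and>
     (\<forall>n\<ge>1. \<forall>w\<in>space M. X (n + 1) w = X n w - \<gamma> n *\<^sub>R V (X n w) (\<omega> n w))"

end

theory Submission
  imports Defs
begin

text \<open>
  The argument is pathwise: every asymptotic pseudotrajectory of the gradient flow is bounded, so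
  the exceptional event is empty. The function \<open>f\<close> serves as an energy.

  Outside a bounded set the gradient is longer than \<open>\<epsilon>\<^sub>0\<close>, so that the flow lowers \<open>f\<close> by at least
  \<open>\<epsilon>\<^sub>0\<^sup>2\<close> per unit of time as long as it stays outside. Once it has met the bounded set, \<open>f\<close> stays
  below a constant \<open>B\<close> (\<open>gradient_flow_unit_time_drop\<close>). After one unit of time an asymptotic
  pseudotrajectory is at distance at most \<open>\<delta>\<close> from the flow line through its current point, where
  \<open>\<delta>\<close> may be taken as small as desired at late times. As \<open>f\<close> is \<open>G\<close>-Lipschitz, this error costs at
  most \<open>G * \<delta> \<le> \<epsilon>\<^sub>0\<^sup>2\<close>, which the gain of the flow pays for. Hence \<open>f\<close> along the curve, sampled at
  unit steps from a late time \<open>t\<^sub>0\<close> on, never exceeds the larger of its value at \<open>t\<^sub>0\<close> and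
  \<open>B + \<epsilon>\<^sub>0\<^sup>2\<close>, and the same estimate controls the times in between
  (\<open>asymptotic_pseudotrajectory_bounded\<close>).

  A bound on \<open>f\<close> along the curve bounds the curve itself because all sublevel sets are bounded. The
  hypothesis gives this only for levels below \<open>sup f\<close>, but \<open>sup f = \<infinity>\<close>: otherwise an ascent step
  from a point with almost maximal value, taken where the gradient is longer than \<open>\<epsilon>\<^sub>0\<close>, would
  exceed the supremum (\<open>unbounded_above_of_nonvanishing_gradient\<close>).

  The flow is defined through a description of its value, which is meaningful only once solutions
  are known to exist for all times and to be unique. Both follow from the Lipschitz bound on the
  gradient (\<open>lipschitz_ode_solution_exists\<close>, \<open>lipschitz_ode_solution_unique\<close>).
\<close>

section \<open>Global flows of Lipschitz vector fields\<close>

lemma has_vector_derivative_integral_from_0: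
  fixes g :: "real \<Rightarrow> 'a::banach"
  assumes "continuous_on {0..} g" "0 \<le> t"
  shows "((\<lambda>u. integral {0..u} g) has_vector_derivative g t) (at t within {0..})"
proof -
  have "((\<lambda>u. integral {0..u} g) has_vector_derivative g t) (at t within {0..t+1})"
    using assms by (intro integral_has_vector_derivative) (auto intro: continuous_on_subset)
  moreover have "at t within {0..t+1} = at t within {0..}"
    by (rule at_within_nhd[where S = "{..<t+1}"]) auto
  ultimately show ?thesis by simp
qed

text \<open>The weight \<open>exp (- K * m)\<close> absorbs the growth of the integral, which makes the bound uniform
  in \<open>m\<close>; a large \<open>K\<close> makes it small.\<close>

lemma norm_weighted_integral_le:
  fixes g :: "real \<Rightarrow> 'a::banach"
  assumes "K > 0" "0 \<le> m" "C \<ge> 0" "continuous_on {0..m} g"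
    and bound: "\<And>s. s \<in> {0..m} \<Longrightarrow> norm (g s) \<le> C * exp (K * s)"
  shows "norm (exp (- K * m) *\<^sub>R integral {0..m} g) \<le> C / K"
proof -
  have I: "((\<lambda>s. C * exp (K * s)) has_integral (C / K * exp (K * m) - C / K * exp (K * 0))) {0..m}"
    using assms(1,2)
    by (intro fundamental_theorem_of_calculus)
       (auto intro!: derivative_eq_intros simp flip: has_real_derivative_iff_has_vector_derivative)
  have "norm (integral {0..m} g) \<le> integral {0..m} (\<lambda>s. C * exp (K * s))"
    by (rule Henstock_Kurzweil_Integration.integral_norm_bound_integral
        [OF integrable_continuous_real[OF assms(4)] has_integral_integrable[OF I] bound])
  also have "\<dots> = C / K * exp (K * m) - C / K * exp (K * 0)"
    using I by (rule integral_unique)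
  also have "\<dots> \<le> C / K * exp (K * m)"
    using assms by simp
  finally have "exp (- K * m) * norm (integral {0..m} g) \<le> exp (- K * m) * (C / K * exp (K * m))"
    by (intro mult_left_mono) auto
  also have "\<dots> = C / K"
    by (simp add: exp_minus)
  finally show ?thesis by simp
qed

text \<open>Picard iteration converges on the whole half-line at once when distances are measured in the
  weighted supremum norm with weight \<open>exp (- K * t)\<close> and \<open>K\<close> larger than the Lipschitz constant.
  A solution \<open>y\<close> is therefore sought as \<open>y t = x\<^sub>0 + exp (K * t) *\<^sub>R u t\<close>, where \<open>u\<close> is a bounded
  continuous function and the fixed point of a contraction.\<close>

lemma lipschitz_ode_solution_exists:
  fixes F :: "'a::banach \<Rightarrow> 'a"
  assumes lip: "\<And>x y. norm (F x - F y) \<le> L * norm (x - y)"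
  shows "\<exists>y. y 0 = x\<^sub>0 \<and> (\<forall>t\<ge>0. (y has_vector_derivative F (y t)) (at t within {0..}))"
proof -
  define K where "K = 2 * \<bar>L\<bar> + 1"
  have K: "K > 0" by (simp add: K_def)
  have lipK: "norm (F x - F y) \<le> K / 2 * norm (x - y)" for x y
    by (rule order.trans[OF lip mult_right_mono]) (auto simp: K_def)
  have contF: "continuous_on A F" for A
    by (rule lipschitz_on_continuous_on[of "K / 2"]) 
      (use K lipK in \<open>auto simp: lipschitz_on_def dist_norm\<close>)
  define g where "g u s = F (x\<^sub>0 + exp (K * s) *\<^sub>R u s)" for u :: "real \<Rightarrow> 'a" and s
  \<comment> \<open>Freezing the operator at negative times lets it act on functions on the whole line, where
     the complete space of bounded continuous functions is available.\<close>
  define P where "P u t = exp (- K * max 0 t) *\<^sub>R integral {0..max 0 t} (g u)" for u t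
  have cont_g: "continuous_on A (g (apply_bcontfun u))" for u A
    unfolding g_def
    by (rule continuous_on_compose2[OF contF[of UNIV]]) (auto intro!: continuous_intros)
  have J: "((\<lambda>t. integral {0..t} (g u)) has_vector_derivative g u t) (at t within {0..})"
    if "0 \<le> t" for t and u :: "real \<Rightarrow>\<^sub>C 'a"
    using has_vector_derivative_integral_from_0[OF cont_g that] .
  have P_bcont: "P u \<in> bcontfun" for u :: "real \<Rightarrow>\<^sub>C 'a"
  proof (rule bcontfun_normI)
    have "continuous_on {0..} (\<lambda>t. integral {0..t} (g u))"
      using J by (auto intro!: has_vector_derivative_continuous simp: continuous_on_eq_continuous_within)
    then have "continuous_on UNIV (\<lambda>t. integral {0..max 0 t} (g u))"
      by (rule continuous_on_compose2) (auto intro!: continuous_intros)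
    then show "continuous_on UNIV (P u)"
      unfolding P_def by (auto intro!: continuous_intros)
    define C where "C = norm (F x\<^sub>0) + K / 2 * norm u"
    fix t
    have "norm (g u s) \<le> C * exp (K * s)" if "s \<ge> 0" for s
    proof -
      have "norm (g u s - F x\<^sub>0) \<le> K / 2 * (exp (K * s) * norm (u s))"
        using lipK[of "x\<^sub>0 + exp (K * s) *\<^sub>R u s" x\<^sub>0] by (simp add: g_def)
      also have "\<dots> \<le> K / 2 * (exp (K * s) * norm u)"
        using K norm_bounded[of u s] by (intro mult_left_mono) auto
      finally have "norm (g u s) \<le> norm (F x\<^sub>0) + K / 2 * (exp (K * s) * norm u)"
        using norm_triangle_ineq2[of "g u s" "F x\<^sub>0"] by linarith
      also have "norm (F x\<^sub>0) \<le> norm (F x\<^sub>0) * exp (K * s)"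
        using K that by (simp add: mult_le_cancel_left1)
      finally show ?thesis by (simp add: C_def algebra_simps)
    qed
    then show "norm (P u t) \<le> C / K"
      unfolding P_def using K
      by (intro norm_weighted_integral_le cont_g) (auto simp: C_def)
  qed
  have contraction: "norm (P u t - P v t) \<le> 1 / 2 * dist u v" for u v :: "real \<Rightarrow>\<^sub>C 'a" and t
  proof -
    have "norm (g u s - g v s) \<le> (K / 2 * dist u v) * exp (K * s)" for s
    proof -
      have "norm (g u s - g v s) \<le> K / 2 * norm (exp (K * s) *\<^sub>R (u s - v s))"
        using lipK[of "x\<^sub>0 + exp (K * s) *\<^sub>R u s" "x\<^sub>0 + exp (K * s) *\<^sub>R v s"]
        by (simp add: g_def algebra_simps)
      also have "\<dots> = K / 2 * (exp (K * s) * dist (u s) (v s))"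
        by (simp add: dist_norm)
      also have "\<dots> \<le> K / 2 * (exp (K * s) * dist u v)"
        using K dist_bounded[of u s v] by (intro mult_left_mono) auto
      finally show ?thesis by (simp add: mult_ac)
    qed
    then have "norm (exp (- K * max 0 t) *\<^sub>R integral {0..max 0 t} (\<lambda>s. g u s - g v s))
        \<le> (K / 2 * dist u v) / K"
      using K by (intro norm_weighted_integral_le continuous_on_diff cont_g) auto
    also have "integral {0..max 0 t} (\<lambda>s. g u s - g v s)
        = integral {0..max 0 t} (g u) - integral {0..max 0 t} (g v)"
      by (intro Henstock_Kurzweil_Integration.integral_diff integrable_continuous_real cont_g)
    finally show ?thesis
      using K by (simp add: P_def algebra_simps)
  qed
  have "dist (Bcontfun (P u)) (Bcontfun (P v)) \<le> 1 / 2 * dist u v" for u v :: "real \<Rightarrow>\<^sub>C 'a"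
    by (rule dist_bound) (use contraction P_bcont in \<open>simp add: Bcontfun_inverse dist_norm\<close>)
  then have "\<exists>!u. Bcontfun (P (apply_bcontfun u)) = u"
    by (intro banach_fix_type[of "1 / 2"]) auto
  then obtain u where "Bcontfun (P (apply_bcontfun u)) = u" by blast
  then have u: "P u t = u t" for t
    using P_bcont by (metis Bcontfun_inverse)
  define y where "y t = x\<^sub>0 + integral {0..t} (g u)" for t
  have y: "y t = x\<^sub>0 + exp (K * t) *\<^sub>R u t" if "t \<ge> 0" for t
    using that by (simp add: y_def P_def exp_minus flip: u)
  have "(y has_vector_derivative F (y t)) (at t within {0..})" if "t \<ge> 0" for t
  proof -
    have "(y has_vector_derivative g u t) (at t within {0..})"
      unfolding y_def using J[OF that, of u] by (auto intro!: derivative_eq_intros)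
    then show ?thesis
      using that by (simp add: y g_def)
  qed
  moreover have "y 0 = x\<^sub>0" by (simp add: y_def)
  ultimately show ?thesis by blast
qed

lemma antimono_on_halflineI:
  fixes \<phi> \<phi>' :: "real \<Rightarrow> real"
  assumes deriv: "\<And>t. 0 \<le> t \<Longrightarrow> (\<phi> has_real_derivative \<phi>' t) (at t within {0..})"
    and nonpos: "\<And>t. a < t \<Longrightarrow> t < b \<Longrightarrow> \<phi>' t \<le> 0" and "0 \<le> a" "a \<le> b"
  shows "\<phi> b \<le> \<phi> a"
proof (rule DERIV_nonpos_imp_decreasing_open[OF \<open>a \<le> b\<close>])
  show "\<exists>y. DERIV \<phi> t :> y \<and> y \<le> 0" if "a < t" "t < b" for t
  proof -
    have "at t within {0..} = at t"
      using that \<open>0 \<le> a\<close> by (intro at_within_interior) simp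
    then show ?thesis using deriv[of t] nonpos[of t] that \<open>0 \<le> a\<close> by auto
  qed
  have "continuous_on {0..} \<phi>"
    using deriv by (auto intro!: DERIV_continuous simp: continuous_on_eq_continuous_within)
  then show "continuous_on {a..b} \<phi>"
    by (rule continuous_on_subset) (use \<open>0 \<le> a\<close> in auto)
qed

text \<open>Gronwall's argument: the squared distance of two solutions grows at most at rate \<open>2 * L\<close>, so
  after multiplication by \<open>exp (- 2 * L * t)\<close> it is nonincreasing, and it starts at zero.\<close>

lemma lipschitz_ode_solution_unique:
  fixes F :: "'a::real_inner \<Rightarrow> 'a"
  assumes lip: "\<And>x y. norm (F x - F y) \<le> L * norm (x - y)"
    and y: "\<And>t. t \<ge> 0 \<Longrightarrow> (y has_vector_derivative F (y t)) (at t within {0..})"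
    and z: "\<And>t. t \<ge> 0 \<Longrightarrow> (z has_vector_derivative F (z t)) (at t within {0..})"
    and "y 0 = z 0" "t \<ge> 0"
  shows "y t = z t"
proof -
  define sqdist where "sqdist t = (y t - z t) \<bullet> (y t - z t)" for t
  define \<phi> where "\<phi> t = exp (- 2 * L * t) * sqdist t" for t
  define \<phi>' where "\<phi>' t = 2 * exp (- 2 * L * t) *
    ((y t - z t) \<bullet> (F (y t) - F (z t)) - L * sqdist t)" for t
  have deriv: "(\<phi> has_real_derivative \<phi>' t) (at t within {0..})" if "t \<ge> 0" for t
  proof -
    have "(sqdist has_real_derivative 2 * ((y t - z t) \<bullet> (F (y t) - F (z t)))) (at t within {0..})"
      using has_derivative_inner[OF
          has_vector_derivative_diff[OF y z, OF that that, unfolded has_vector_derivative_def]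
          has_vector_derivative_diff[OF y z, OF that that, unfolded has_vector_derivative_def]]
      unfolding has_field_derivative_def sqdist_def
      by (rule has_derivative_eq_rhs) (auto simp: fun_eq_iff inner_commute algebra_simps)
    then show ?thesis
      unfolding \<phi>_def \<phi>'_def by (auto intro!: derivative_eq_intros simp: algebra_simps)
  qed
  have nonpos: "\<phi>' t \<le> 0" for t
  proof -
    have "(y t - z t) \<bullet> (F (y t) - F (z t)) \<le> norm (y t - z t) * norm (F (y t) - F (z t))"
      by (rule norm_cauchy_schwarz)
    also have "\<dots> \<le> norm (y t - z t) * (L * norm (y t - z t))"
      by (intro mult_left_mono lip) auto
    also have "\<dots> = L * sqdist t"
      by (simp add: sqdist_def dot_square_norm power2_eq_square)
    finally show ?thesis
      by (simp add: \<phi>'_def mult_nonneg_nonpos)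
  qed
  have "\<phi> t \<le> \<phi> 0"
    by (rule antimono_on_halflineI[OF deriv nonpos order.refl \<open>t \<ge> 0\<close>])
  then have "(y t - z t) \<bullet> (y t - z t) \<le> 0"
    using \<open>y 0 = z 0\<close> by (simp add: \<phi>_def sqdist_def mult_le_0_iff)
  then have "(y t - z t) \<bullet> (y t - z t) = 0"
    by (intro order.antisym inner_ge_zero)
  then show ?thesis
    by (simp only: inner_eq_zero_iff right_minus_eq)
qed

section \<open>Descent along the gradient flow\<close>

lemma GDERIV_grad:
  fixes f :: "'a::euclidean_space \<Rightarrow> real"
  assumes "f differentiable (at x)"
  shows "GDERIV f x :> grad f x"
proof -
  obtain D where D: "(f has_derivative D) (at x)"
    using assms by (auto simp: differentiable_def)
  interpret bounded_linear D by (rule has_derivative_bounded_linear[OF D])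
  have "h \<bullet> adjoint D 1 = D h" for h
    using adjoint_works[of D h 1] linear_axioms by simp
  then have D_eq: "(\<lambda>h. h \<bullet> adjoint D 1) = D" by (rule ext)
  have "GDERIV f x :> adjoint D 1"
    unfolding gderiv_def D_eq by (rule D)
  then show ?thesis by (simp add: grad_eqI)
qed

lemma gradient_flow_eq:
  fixes f :: "'a::euclidean_space \<Rightarrow> real"
  assumes lip: "\<And>x x'. norm (grad f x' - grad f x) \<le> L * norm (x' - x)"
    and sol: "gradient_solution f x y" and "t \<ge> 0"
  shows "gradient_flow f t x = y t"
  unfolding gradient_flow_def
proof (rule the_equality)
  fix z assume "\<exists>y. gradient_solution f x y \<and> y t = z"
  then obtain y' where y': "gradient_solution f x y'" "y' t = z" by blast
  have "y' t = y t"
    by (rule lipschitz_ode_solution_unique[where F = "\<lambda>x. - grad f x" and L = L])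
      (use lip y' sol \<open>t \<ge> 0\<close> in \<open>auto simp: gradient_solution_def norm_minus_commute\<close>)
  then show "z = y t" using y' by simp
qed (use sol in blast)

lemma gradient_solution_exists:
  fixes f :: "'a::euclidean_space \<Rightarrow> real"
  assumes "\<And>x x'. norm (grad f x' - grad f x) \<le> L * norm (x' - x)"
  obtains y where "gradient_solution f x y"
proof -
  have "\<exists>y. y 0 = x \<and> (\<forall>t\<ge>0. (y has_vector_derivative - grad f (y t)) (at t within {0..}))"
    by (rule lipschitz_ode_solution_exists[where L = L])
      (use assms in \<open>auto simp: norm_minus_commute\<close>)
  then show ?thesis using that by (auto simp: gradient_solution_def)
qed

lemma gradient_solution_descent:
  fixes f :: "'a::euclidean_space \<Rightarrow> real"
  assumes diff: "\<And>x. GDERIV f x :> grad f x"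
    and sol: "gradient_solution f x y" and "t \<ge> 0"
  shows "((\<lambda>t. f (y t)) has_real_derivative - (norm (grad f (y t)))\<^sup>2) (at t within {0..})"
proof -
  have "(y has_derivative (\<lambda>s. s *\<^sub>R (- grad f (y t)))) (at t within {0..})"
    using sol \<open>t \<ge> 0\<close> by (simp add: gradient_solution_def has_vector_derivative_def)
  from has_derivative_compose[OF this diff[of "y t", unfolded gderiv_def]]
  show ?thesis
    unfolding has_field_derivative_def
    by (rule has_derivative_eq_rhs) (simp add: fun_eq_iff power2_norm_eq_inner)
qed

text \<open>Within one unit of time the flow either meets the region of small gradient, after which \<open>f\<close>
  stays below its bound there, or \<open>f\<close> decreases at a rate of at least \<open>\<epsilon>\<^sup>2\<close> throughout.\<close>

lemma gradient_flow_unit_time_drop: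
  fixes f :: "'a::euclidean_space \<Rightarrow> real"
  assumes diff: "\<And>x. GDERIV f x :> grad f x"
    and sol: "gradient_solution f x y" and "\<epsilon> \<ge> 0"
    and B: "\<And>x. norm (grad f x) \<le> \<epsilon> \<Longrightarrow> f x \<le> B"
  shows "f (y 1) \<le> max (f x - \<epsilon>\<^sup>2) B"
proof (cases "\<exists>h\<in>{0..1}. norm (grad f (y h)) \<le> \<epsilon>")
  case True
  then obtain h where h: "h \<in> {0..1}" "norm (grad f (y h)) \<le> \<epsilon>" by blast
  have "f (y 1) \<le> f (y h)"
    by (rule antimono_on_halflineI[OF gradient_solution_descent[OF diff sol]]) (use h in auto)
  also have "\<dots> \<le> B" by (rule B) fact
  finally show ?thesis by simp
next
  case False
  have "f (y 1) + \<epsilon>\<^sup>2 * 1 \<le> f (y 0) + \<epsilon>\<^sup>2 * 0"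
  proof (rule antimono_on_halflineI[where \<phi> = "\<lambda>t. f (y t) + \<epsilon>\<^sup>2 * t"
        and \<phi>' = "\<lambda>t. - (norm (grad f (y t)))\<^sup>2 + \<epsilon>\<^sup>2" and a = 0 and b = 1])
    show "((\<lambda>t. f (y t) + \<epsilon>\<^sup>2 * t) has_real_derivative - (norm (grad f (y t)))\<^sup>2 + \<epsilon>\<^sup>2)
        (at t within {0..})" if "0 \<le> t" for t
      by (auto intro!: derivative_eq_intros gradient_solution_descent[OF diff sol that])
    show "- (norm (grad f (y t)))\<^sup>2 + \<epsilon>\<^sup>2 \<le> 0" if "0 < t" "t < 1" for t
    proof -
      have "\<epsilon> \<le> norm (grad f (y t))"
        using False that by (meson atLeastAtMost_iff less_imp_le linorder_not_le)
      then show ?thesis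
        using \<open>\<epsilon> \<ge> 0\<close> by (simp add: power_mono)
    qed
  qed auto
  then show ?thesis using sol by (simp add: gradient_solution_def)
qed

text \<open>If \<open>f\<close> were bounded above, far away its values would be within any prescribed margin of its
  supremum while its gradient stays longer than \<open>\<epsilon>\<close>. A single gradient ascent step whose length is
  adapted to the Lipschitz constant raises \<open>f\<close> by a fixed amount, and so overshoots the supremum.\<close>

lemma unbounded_above_of_nonvanishing_gradient:
  fixes f :: "'a::euclidean_space \<Rightarrow> real"
  assumes diff: "\<And>x. GDERIV f x :> grad f x"
    and lip: "\<And>x x'. norm (grad f x' - grad f x) \<le> L * norm (x' - x)"
    and sublevels: "\<And>c::real. ereal c < (SUP x. ereal (f x)) \<Longrightarrow> bounded {x. f x \<le> c}"
    and near_critical: "\<epsilon> > 0" "bounded {x. norm (grad f x) \<le> \<epsilon>}"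
  shows "(SUP x. ereal (f x)) = \<infinity>"
proof (rule ccontr)
  assume "(SUP x. ereal (f x)) \<noteq> \<infinity>"
  moreover have "ereal (f 0) \<le> (SUP x. ereal (f x))"
    by (rule SUP_upper) simp
  ultimately obtain s where s: "(SUP x. ereal (f x)) = ereal s"
    by (cases "SUP x. ereal (f x)") auto
  have le_s: "f x \<le> s" for x
    using SUP_upper[of x UNIV "\<lambda>x. ereal (f x)"] s by simp
  \<comment> \<open>Along a step of this length times the gradient, the gradient changes by at most half of its
     initial length, so \<open>f\<close> rises at no less than half of its initial rate.\<close>
  define a where "a = 1 / (2 * (\<bar>L\<bar> + 1))"
  have a: "a > 0" "\<bar>L\<bar> * a \<le> 1 / 2"
    by (auto simp: a_def field_simps)
  define \<eta> where "\<eta> = a * \<epsilon>\<^sup>2 / 2"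
  have "\<eta> > 0" using a near_critical by (simp add: \<eta>_def)
  then have "bounded ({x. f x \<le> s - \<eta>} \<union> {x. norm (grad f x) \<le> \<epsilon>})"
    using sublevels[of "s - \<eta>"] s near_critical by simp
  then obtain x where x: "f x > s - \<eta>" "norm (grad f x) > \<epsilon>"
    using not_bounded_UNIV
    by (metis (mono_tags, lifting) UNIV_eq_I UnCI linorder_not_le mem_Collect_eq)
  define v where "v = grad f x"
  have "\<exists>t\<in>{0..a}. f (x + a *\<^sub>R v) - f (x + 0 *\<^sub>R v) = (a - 0) * (v \<bullet> grad f (x + t *\<^sub>R v))"
  proof (rule mvt_very_simple[of 0 a "\<lambda>t. f (x + t *\<^sub>R v)" "\<lambda>t h. h * (v \<bullet> grad f (x + t *\<^sub>R v))"])
    fix t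
    have "((\<lambda>t. x + t *\<^sub>R v) has_derivative (\<lambda>h. h *\<^sub>R v)) (at t within {0..a})"
      by (auto intro!: derivative_eq_intros)
    from has_derivative_compose[OF this diff[of "x + t *\<^sub>R v", unfolded gderiv_def]]
    show "((\<lambda>t. f (x + t *\<^sub>R v)) has_derivative (\<lambda>h. h * (v \<bullet> grad f (x + t *\<^sub>R v))))
        (at t within {0..a})"
      by simp
  qed (use a in simp)
  then obtain t where t: "0 \<le> t" "t \<le> a"
    and step: "f (x + a *\<^sub>R v) = f x + a * (v \<bullet> grad f (x + t *\<^sub>R v))" by auto
  have "norm (grad f (x + t *\<^sub>R v) - v) \<le> L * (t * norm v)"
    using lip[of "x + t *\<^sub>R v" x] t by (simp add: v_def)
  also have "\<dots> \<le> \<bar>L\<bar> * (a * norm v)"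
    using t by (intro mult_mono) auto
  also have "\<dots> \<le> 1 / 2 * norm v"
    using mult_right_mono[OF a(2), of "norm v"] by (simp add: mult.assoc)
  finally have close: "norm (grad f (x + t *\<^sub>R v) - v) \<le> 1 / 2 * norm v" .
  have "- (v \<bullet> (grad f (x + t *\<^sub>R v) - v)) \<le> norm v * (1 / 2 * norm v)"
    by (rule order.trans[OF abs_ge_minus_self
          order.trans[OF Cauchy_Schwarz_ineq2 mult_left_mono[OF close]]]) simp
  then have "(norm v)\<^sup>2 / 2 \<le> v \<bullet> grad f (x + t *\<^sub>R v)"
    by (simp add: inner_diff_right power2_norm_eq_inner[symmetric] power2_eq_square)
  moreover have "\<epsilon>\<^sup>2 \<le> (norm v)\<^sup>2"
    using x near_critical by (simp add: v_def power_mono)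
  ultimately have "\<epsilon>\<^sup>2 / 2 \<le> v \<bullet> grad f (x + t *\<^sub>R v)"
    by linarith
  from mult_left_mono[OF this, of a] have "\<eta> \<le> a * (v \<bullet> grad f (x + t *\<^sub>R v))"
    using a by (simp add: \<eta>_def)
  then show False
    using step x le_s[of "x + a *\<^sub>R v"] by linarith
qed

section \<open>Boundedness of asymptotic pseudotrajectories\<close>

lemma grad_bounded_imp_lipschitz:
  fixes f :: "'a::euclidean_space \<Rightarrow> real"
  assumes diff: "\<And>x. GDERIV f x :> grad f x" and "\<And>x. norm (grad f x) \<le> G"
  shows "\<bar>f x - f y\<bar> \<le> G * norm (x - y)"
proof -
  have "norm (f x - f y) \<le> G * norm (x - y)"
  proof (rule differentiable_bound[where S = UNIV and f' = "\<lambda>x h. h \<bullet> grad f x"])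
    fix x
    have "norm (h \<bullet> grad f x) \<le> G * norm h" for h
      using Cauchy_Schwarz_ineq2[of h "grad f x"] mult_left_mono[OF assms(2)[of x], of "norm h"]
      by (simp add: mult.commute)
    then show "onorm (\<lambda>h. h \<bullet> grad f x) \<le> G"
      by (rule onorm_le)
  qed (use diff in \<open>auto simp: gderiv_def\<close>)
  then show ?thesis by simp
qed

text \<open>Over unit time windows the error of the pseudotrajectory eventually raises \<open>f\<close> by no more than
  the flow lowers it where the gradient is long. Sampled at unit time steps, \<open>f\<close> along the curve thus
  never exceeds the larger of its initial value and a constant, and coercivity turns this into a
  bound on the curve.\<close>

lemma asymptotic_pseudotrajectory_bounded:
  fixes f :: "'a::euclidean_space \<Rightarrow> real"
  assumes diff: "\<And>x. GDERIV f x :> grad f x"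
    and grad_bounded: "\<And>x. norm (grad f x) \<le> G"
    and lip: "\<And>x x'. norm (grad f x' - grad f x) \<le> L * norm (x' - x)"
    and coercive: "\<And>c. bounded {x. f x \<le> c}"
    and near_critical: "\<epsilon> > 0" "bounded {x. norm (grad f x) \<le> \<epsilon>}"
    and apt: "asymptotic_pseudotrajectory f Y"
  shows "bounded (Y ` {0..})"
proof -
  have G: "G \<ge> 0" using grad_bounded norm_ge_zero order.trans by blast
  note f_lip = grad_bounded_imp_lipschitz[OF diff grad_bounded]
  obtain R where R: "\<And>x. norm (grad f x) \<le> \<epsilon> \<Longrightarrow> norm x \<le> R"
    using near_critical(2) by (auto simp: bounded_iff)
  define B where "B = f 0 + G * R"
  have B: "f x \<le> B" if "norm (grad f x) \<le> \<epsilon>" for x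
    using f_lip[of x 0] mult_left_mono[OF R[OF that] G] by (simp add: B_def)
  define \<delta> where "\<delta> = \<epsilon>\<^sup>2 / (G + 1)"
  have \<delta>: "\<delta> > 0" "G * \<delta> \<le> \<epsilon>\<^sup>2"
    using G near_critical by (auto simp: \<delta>_def field_simps)
  have "((\<lambda>t. SUP h\<in>{0..1}. ereal (norm (Y (t + h) - gradient_flow f h (Y t)))) \<longlongrightarrow> 0) at_top"
    using apt by (auto simp: asymptotic_pseudotrajectory_def)
  then have "\<forall>\<^sub>F t in at_top.
      (SUP h\<in>{0..1}. ereal (norm (Y (t + h) - gradient_flow f h (Y t)))) < ereal \<delta>"
    using \<delta> by (intro order_tendstoD(2)) auto
  then obtain t\<^sub>1 where t\<^sub>1: "\<And>t. t \<ge> t\<^sub>1 \<Longrightarrow>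
      (SUP h\<in>{0..1}. ereal (norm (Y (t + h) - gradient_flow f h (Y t)))) < ereal \<delta>"
    by (auto simp: eventually_at_top_linorder)
  define t\<^sub>0 where "t\<^sub>0 = max t\<^sub>1 0"
  have near_flow: "\<bar>f (Y (t + h)) - f (y h)\<bar> \<le> \<epsilon>\<^sup>2"
    if "t \<ge> t\<^sub>0" "h \<in> {0..1}" "gradient_solution f (Y t) y" for t h y
  proof -
    have "ereal (norm (Y (t + h) - gradient_flow f h (Y t))) < ereal \<delta>"
      by (rule le_less_trans[OF SUP_upper t\<^sub>1]) (use that in \<open>auto simp: t\<^sub>0_def\<close>)
    then have "norm (Y (t + h) - y h) \<le> \<delta>"
      using gradient_flow_eq[OF lip that(3), of h] that by simp
    then show ?thesis
      using f_lip[of "Y (t + h)" "y h"] mult_left_mono[OF _ G] \<delta>(2) by (meson order.trans)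
  qed
  define C where "C = max (f (Y t\<^sub>0)) (B + \<epsilon>\<^sup>2)"
  have integer_times: "f (Y (t\<^sub>0 + real n)) \<le> C" for n
  proof (induction n)
    case (Suc n)
    obtain y where y: "gradient_solution f (Y (t\<^sub>0 + real n)) y"
      using gradient_solution_exists[OF lip] .
    have "f (Y (t\<^sub>0 + real n + 1)) \<le> f (y 1) + \<epsilon>\<^sup>2"
      using near_flow[OF _ _ y, of 1] by simp
    also have "f (y 1) \<le> max (f (Y (t\<^sub>0 + real n)) - \<epsilon>\<^sup>2) B"
      using gradient_flow_unit_time_drop[OF diff y _ B] near_critical by simp
    finally show ?case
      using Suc by (simp add: C_def algebra_simps max_def split: if_splits)
  qed (simp add: C_def)
  have "f (Y t) \<le> C + \<epsilon>\<^sup>2" if "t \<ge> t\<^sub>0" for t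
  proof -
    define n where "n = nat \<lfloor>t - t\<^sub>0\<rfloor>"
    define h where "h = t - t\<^sub>0 - real n"
    have h: "h \<in> {0..1}" "t = t\<^sub>0 + real n + h"
      using that by (auto simp: h_def n_def) linarith+
    obtain y where y: "gradient_solution f (Y (t\<^sub>0 + real n)) y"
      using gradient_solution_exists[OF lip] .
    have "f (y h) \<le> f (y 0)"
      by (rule antimono_on_halflineI[OF gradient_solution_descent[OF diff y]]) (use h in auto)
    then show ?thesis
      using near_flow[OF _ h(1) y] integer_times[of n] y h by (simp add: gradient_solution_def)
  qed
  then have "bounded (Y ` {t\<^sub>0..})"
    by (intro bounded_subset[OF coercive[of "C + \<epsilon>\<^sup>2"]]) auto
  moreover have "bounded (Y ` {0..t\<^sub>0})"
    using apt unfolding asymptotic_pseudotrajectory_def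
    by (intro compact_imp_bounded compact_continuous_image) (auto intro: continuous_on_subset)
  moreover have "Y ` {0..} \<subseteq> Y ` {0..t\<^sub>0} \<union> Y ` {t\<^sub>0..}"
    unfolding image_Un[symmetric] by (rule image_mono) auto
  ultimately show ?thesis
    by (meson bounded_Un bounded_subset)
qed

theorem theorem1:
  fixes f :: "real ^ 'd \<Rightarrow> real"
    and Z :: "real ^ 'd \<Rightarrow> 's \<Rightarrow> real ^ 'd"
    and S :: "'s measure" and M :: "'w measure"
    and \<omega> :: "nat \<Rightarrow> 'w \<Rightarrow> 's" and X :: "nat \<Rightarrow> 'w \<Rightarrow> real ^ 'd"
    and \<gamma> :: "nat \<Rightarrow> real" and G L \<epsilon>\<^sub>0 \<sigma> p :: real and q :: ereal
  assumes smooth: "times_cont_differentiable CARD('d) f"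
    and constants: "G \<ge> 0" "L \<ge> 0"
    and grad_bounded: "\<And>x. norm (grad f x) \<le> G"
    and grad_Lipschitz: "\<And>x x'. norm (grad f x' - grad f x) \<le> L * norm (x' - x)"
    and sublevels: "\<And>c::real. ereal c < (SUP x. ereal (f x)) \<Longrightarrow> bounded {x. f x \<le> c}"
    and near_critical: "\<epsilon>\<^sub>0 > 0" "bounded {x. norm (grad f x) \<le> \<epsilon>\<^sub>0}"
    and seed_space: "prob_space S" "complete_measure S"
    and noise_measurable: "(\<lambda>(x, s). Z x s) \<in> borel_measurable (borel \<Otimes>\<^sub>M S)"
    and moments: "2 \<le> q" "\<sigma> \<ge> 0"
    and noise_mean: "\<And>x. integrable S (Z x)" "\<And>x. (\<integral>s. Z x s \<partial>S) = 0"
    and noise_moment: "\<And>x. moment_bound S q \<sigma> (Z x)"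
    and step_sizes: "\<exists>c>0. \<forall>n\<ge>1. \<gamma> n = c * (1 / real n powr p)"
    and exponent: "2 / (q + 2) < ereal p" "p \<le> 1"
    and process: "prob_space M" "sgd M S (\<lambda>x s. grad f x + Z x s) \<gamma> \<omega> X"
  shows "AE w in M. \<forall>Y. interpolates \<gamma> (\<lambda>n. X n w) Y \<and> asymptotic_pseudotrajectory f Y
           \<longrightarrow> (SUP t\<in>{0..}. ereal (norm (Y t))) < \<infinity>"
proof -
  have "0 < CARD('d)" by simp
  then obtain k where "CARD('d) = Suc k"
    using gr0_implies_Suc by blast
  then have "\<And>x. f differentiable (at x)"
    using smooth by simp
  then have diff: "\<And>x. GDERIV f x :> grad f x"
    by (rule GDERIV_grad)
  have "(SUP x. ereal (f x)) = \<infinity>"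
    by (rule unbounded_above_of_nonvanishing_gradient[OF diff grad_Lipschitz sublevels near_critical])
  then have coercive: "\<And>c. bounded {x. f x \<le> c}"
    using sublevels by simp
  have "(SUP t\<in>{0..}. ereal (norm (Y t))) < \<infinity>" if "asymptotic_pseudotrajectory f Y" for Y
  proof -
    have "bounded (Y ` {0..})"
      by (rule asymptotic_pseudotrajectory_bounded
            [OF diff grad_bounded grad_Lipschitz coercive near_critical that])
    then obtain b where "\<And>t. t \<ge> 0 \<Longrightarrow> norm (Y t) \<le> b"
      by (auto simp: bounded_iff)
    then have "(SUP t\<in>{0..}. ereal (norm (Y t))) \<le> ereal b"
      by (intro SUP_least) simp
    then show ?thesis
      by (rule le_less_trans) simp
  qed
  then show ?thesis
    by (intro AE_I2) blast
qed

end
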